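(* Let $n\ge2$ and let $c$ be a conjugacy class of $\mathrm{Sym}(n)$ consisting of odd permutations. If $S$ is an independent set in the Cayley graph $\Gamma(\mathrm{Sym}(n);c)$, then $|S|\le n!/2$, and equality holds if and only if $S$ is either $\mathrm{Alt}(n)$ or $(1\,2)\mathrm{Alt}(n)$.
   Context: For a group $G$ and a subset $S\subseteq G$ closed under inversion and not containing the identity, the Cayley graph $\Gamma(G;S)$ has vertex set $G$, with $g$ and $h$ adjacent iff $gh^{-1}\in S$. An independent set is a set of pairwise non-adjacent vertices. *)

theory Defs
  imports "HOL-Algebra.Sym_Groups" "HOL-Algebra.Group_Action" "Graph_Theory.Digraph"
begin

definition conjugacy_classes :: "('a, 'b) monoid_scheme \<Rightarrow> 'a set set" where
  "conjugacy_classes G =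
     orbits G (carrier G) (\<lambda>g. \<lambda>h \<in> carrier G. g \<otimes>\<^bsub>G\<^esub> h \<otimes>\<^bsub>G\<^esub> inv\<^bsub>G\<^esub> g)"

text \<open>
  Undirected graphs are represented as symmetric digraphs, as in the locale \<^locale>\<open>graph\<close>.
  The definition is total in the connection set; the result is an undirected
  loop-free graph under the usual conditions on it, see \<open>graph_cayley_graph\<close> below.
\<close>

definition cayley_graph :: "('a, 'b) monoid_scheme \<Rightarrow> 'a set \<Rightarrow> ('a, 'a \<times> 'a) pre_digraph" where
  "cayley_graph G S =
     \<lparr> verts = carrier G,
       arcs = {(g, h). g \<in> carrier G \<and> h \<in> carrier G \<and> g \<otimes>\<^bsub>G\<^esub> inv\<^bsub>G\<^esub> h \<in> S},
       tail = fst,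
       head = snd \<rparr>"

definition independent_set :: "('a, 'b) pre_digraph \<Rightarrow> 'a set \<Rightarrow> bool" where
  "independent_set \<Gamma> S \<longleftrightarrow> S \<subseteq> verts \<Gamma> \<and> pairwise (\<lambda>u v. \<not> u \<rightarrow>\<^bsub>\<Gamma>\<^esub> v) S"

lemma cayley_graph_adj_iff:
  "g \<rightarrow>\<^bsub>cayley_graph G S\<^esub> h \<longleftrightarrow>
     g \<in> carrier G \<and> h \<in> carrier G \<and> g \<otimes>\<^bsub>G\<^esub> inv\<^bsub>G\<^esub> h \<in> S"
  by (auto simp: cayley_graph_def arcs_ends_conv)

lemma mem_conjugacy_classes_iff:
  "C \<in> conjugacy_classes G \<longleftrightarrow>
     (\<exists>x\<in>carrier G. C = {g \<otimes>\<^bsub>G\<^esub> x \<otimes>\<^bsub>G\<^esub> inv\<^bsub>G\<^esub> g | g. g \<in> carrier G})"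
  by (auto simp: conjugacy_classes_def orbits_def Group_Action.orbit_def)

lemma (in group) graph_cayley_graph:
  assumes "finite (carrier G)" "\<one> \<notin> S" "\<And>s. s \<in> S \<Longrightarrow> inv s \<in> S"
  shows "graph (cayley_graph G S)"
proof
  have "arcs (cayley_graph G S) \<subseteq> carrier G \<times> carrier G"
    by (auto simp: cayley_graph_def)
  then show "finite (arcs (cayley_graph G S))"
    using assms(1) by (meson finite_SigmaI finite_subset)
  show "symmetric (cayley_graph G S)"
    unfolding Digraph.symmetric_def
  proof (rule symI)
    fix g h assume "g \<rightarrow>\<^bsub>cayley_graph G S\<^esub> h"
    then have gh: "g \<in> carrier G" "h \<in> carrier G" "g \<otimes> inv h \<in> S"
      by (auto simp: cayley_graph_adj_iff)
    have "inv (g \<otimes> inv h) = h \<otimes> inv g"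
      using gh by (simp add: inv_mult_group)
    then show "h \<rightarrow>\<^bsub>cayley_graph G S\<^esub> g"
      using gh assms(3)[OF gh(3)] by (simp add: cayley_graph_adj_iff)
  qed
qed (use assms in \<open>auto simp: cayley_graph_def arc_to_ends_def\<close>)

end

theory Submission
  imports Defs
begin

text \<open>
  Left multiplication by any \<open>x \<in> c\<close> maps an independent set \<open>S\<close> injectively into its
  complement, so \<open>S\<close> contains at most half of the group. If it contains exactly half, every
  \<open>x \<in> c\<close> interchanges \<open>S\<close> and its complement, so \<open>S\<close> is stable under the normal subgroup
  generated by the quotients \<open>x y\<^sup>-\<^sup>1\<close> with \<open>x, y \<in> c\<close>. Taking \<open>x = t y t\<^sup>-\<^sup>1\<close> for a
  transposition \<open>t\<close> exhibits in this subgroup products of two transpositions, and from them a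
  3-cycle; hence it contains the alternating group, and \<open>S\<close> is one of its two cosets.
\<close>

section \<open>Half-size independent sets in Cayley graphs\<close>

text \<open>The quotient of \<open>x \<otimes> s\<close> by \<open>s\<close> is \<open>x\<close>, so
  the two are adjacent. Since \<open>x\<close> is not the identity they are distinct, as the
  pairwise condition demands.\<close>

lemma (in group) independent_set_cayley_graph_mult_notin:
  assumes "independent_set (cayley_graph G c) S" "c \<subseteq> carrier G" "\<one> \<notin> c" "x \<in> c" "s \<in> S"
  shows "x \<otimes> s \<notin> S"
proof
  assume xs: "x \<otimes> s \<in> S"
  have S: "S \<subseteq> carrier G"
    using assms(1) by (simp add: independent_set_def cayley_graph_def)
  have x: "x \<in> carrier G" and s: "s \<in> carrier G"
    using assms S by auto
  have quot: "x \<otimes> s \<otimes> inv s = x"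
    using x s by (simp add: m_assoc)
  moreover have "x \<otimes> s \<noteq> s"
    using x s assms(3,4) by auto
  ultimately show False
    using assms(1,4,5) xs s m_closed[OF x s] unfolding independent_set_def pairwise_def cayley_graph_adj_iff
    by metis
qed

lemma (in group) independent_set_cayley_graph_card_le:
  assumes "finite (carrier G)" "independent_set (cayley_graph G c) S"
    "c \<subseteq> carrier G" "\<one> \<notin> c" "c \<noteq> {}"
  shows "2 * card S \<le> order G"
proof -
  obtain x where x: "x \<in> c" using assms by blast
  have S: "S \<subseteq> carrier G"
    using assms(2) by (simp add: independent_set_def cayley_graph_def)
  have fin: "finite S" using S assms(1) finite_subset by blast
  have "(\<lambda>s. x \<otimes> s) ` S \<subseteq> carrier G - S"
    using independent_set_cayley_graph_mult_notin[OF assms(2,3,4) x] x S assms(3) by auto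
  moreover have "inj_on (\<lambda>s. x \<otimes> s) S"
    using inj_on_cmult[of x] x S assms(3) inj_on_subset by blast
  ultimately have "card S \<le> card (carrier G - S)"
    using assms(1) by (meson card_inj_on_le finite_Diff)
  also have "\<dots> = order G - card S"
    using S fin by (simp add: card_Diff_subset order_def)
  moreover have "card S \<le> order G"
    using S assms(1) by (simp add: card_mono order_def)
  ultimately show ?thesis by simp
qed

text \<open>At half the order, the injection of \<open>S\<close> into its complement is onto by
  counting. A product lying outside \<open>S\<close> is therefore \<open>x \<otimes> s'\<close> with
  \<open>s'\<close> in \<open>S\<close>, and cancelling \<open>x\<close> identifies the
  factor.\<close>

lemma (in group) half_independent_set_cayley_graph_mult_iff:
  assumes "finite (carrier G)" "independent_set (cayley_graph G c) S"
    "c \<subseteq> carrier G" "\<one> \<notin> c" "2 * card S = order G" "x \<in> c" "s \<in> carrier G"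
  shows "x \<otimes> s \<in> S \<longleftrightarrow> s \<notin> S"
proof -
  have S: "S \<subseteq> carrier G"
    using assms(2) by (simp add: independent_set_def cayley_graph_def)
  have x: "x \<in> carrier G" using assms by auto
  have fin: "finite S" using S assms(1) finite_subset by blast
  have sub: "(\<lambda>s. x \<otimes> s) ` S \<subseteq> carrier G - S"
    using independent_set_cayley_graph_mult_notin[OF assms(2,3,4,6)] x S by auto
  have inj: "inj_on (\<lambda>s. x \<otimes> s) S"
    using inj_on_cmult[OF x] S inj_on_subset by blast
  have "card ((\<lambda>s. x \<otimes> s) ` S) = card (carrier G - S)"
    using S fin assms(5) by (simp add: card_image[OF inj] card_Diff_subset order_def)
  then have img: "(\<lambda>s. x \<otimes> s) ` S = carrier G - S"
    using sub assms(1) by (simp add: card_subset_eq)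
  show ?thesis
  proof
    assume "x \<otimes> s \<in> S"
    then show "s \<notin> S"
      using independent_set_cayley_graph_mult_notin[OF assms(2,3,4,6)] by blast
  next
    assume s: "s \<notin> S"
    show "x \<otimes> s \<in> S"
    proof (rule ccontr)
      assume "x \<otimes> s \<notin> S"
      then have "x \<otimes> s \<in> (\<lambda>s. x \<otimes> s) ` S"
        using img x assms(7) by auto
      then obtain s' where "s' \<in> S" "x \<otimes> s = x \<otimes> s'" by auto
      then show False using s x assms(7) S by auto
    qed
  qed
qed

text \<open>Each factor of a quotient exchanges \<open>S\<close> with its complement, and two
  exchanges cancel; induction carries this over to the generated subgroup.\<close>

lemma (in group) half_independent_set_cayley_graph_generate:
  assumes "finite (carrier G)" "independent_set (cayley_graph G c) S"
    "c \<subseteq> carrier G" "\<one> \<notin> c" "2 * card S = order G"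
    and "k \<in> generate G {x \<otimes> inv y | x y. x \<in> c \<and> y \<in> c}" "s \<in> carrier G"
  shows "k \<otimes> s \<in> S \<longleftrightarrow> s \<in> S"
proof -
  note iff = half_independent_set_cayley_graph_mult_iff[OF assms(1-5)]
  have quot: "x \<otimes> inv y \<otimes> s \<in> S \<longleftrightarrow> s \<in> S" if "x \<in> c" "y \<in> c" "s \<in> carrier G" for x y s
  proof -
    have xy: "x \<in> carrier G" "y \<in> carrier G" using that assms(3) by auto
    have "x \<otimes> inv y \<otimes> s = x \<otimes> (inv y \<otimes> s)"
      using xy that by (simp add: m_assoc)
    moreover have "y \<otimes> (inv y \<otimes> s) = s"
      using xy that by (simp add: m_assoc[symmetric])
    ultimately show ?thesis
      using iff[of x "inv y \<otimes> s"] iff[of y "inv y \<otimes> s"] xy that by simp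
  qed
  have gen: "generate G {x \<otimes> inv y | x y. x \<in> c \<and> y \<in> c} \<subseteq> carrier G"
    using assms(3) by (intro generate_incl) auto
  from assms(6,7) show ?thesis
  proof (induction arbitrary: s rule: generate.induct)
    case (inv h)
    then obtain x y where xy: "h = x \<otimes> inv y" "x \<in> c" "y \<in> c" by auto
    then have "x \<in> carrier G" "y \<in> carrier G" using assms(3) by auto
    then have "inv h = y \<otimes> inv x" using xy by (simp add: inv_mult_group)
    then show ?case using quot[of y x s] xy inv.prems by simp
  next
    case (eng h1 h2)
    then have "h1 \<in> carrier G" "h2 \<in> carrier G" using gen by auto
    then show ?case using eng by (simp add: m_assoc)
  qed (use quot in auto)
qed

section \<open>Normal subgroups of the symmetric group containing the alternating group\<close>

lemma conjugate_transpose: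
  assumes "bij p"
  shows "p \<circ> transpose a b \<circ> inv' p = transpose (p a) (p b)"
  \<comment> \<open>The rule for cycles asks for a list without repetition; if \<open>a = b\<close>,
    both sides are the identity.\<close>
  using conjugation_of_cycle[of "[a, b]" p] assms
  by (cases "a = b") (auto simp: fun_eq_iff bij_is_surj surj_f_inv_f)

lemma conjugate_two_transpositions:
  assumes "bij p"
  shows "p \<circ> (transpose a b \<circ> transpose d e) \<circ> inv' p
    = transpose (p a) (p b) \<circ> transpose (p d) (p e)"
proof -
  have "p \<circ> (transpose a b \<circ> transpose d e) \<circ> inv' p
    = (p \<circ> transpose a b \<circ> inv' p) \<circ> (p \<circ> transpose d e \<circ> inv' p)"
    using assms by (auto simp: fun_eq_iff bij_is_inj)
  then show ?thesis using assms by (simp only: conjugate_transpose)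
qed

text \<open>Three-fold transitivity, which makes all 3-cycles conjugate in the symmetric
  group.\<close>

lemma permutes_moving_three:
  assumes "distinct [a, b, d]" "distinct [a', b', d']"
    "{a, b, d} \<subseteq> A" "{a', b', d'} \<subseteq> A"
  obtains p where "p permutes A" "p a = a'" "p b = b'" "p d = d'"
proof -
  \<comment> \<open>One point is put in place at a time. By injectivity the next point to be
    corrected never sits on a target already reached, so the new transposition leaves those targets
    fixed.\<close>
  define p1 where "p1 = transpose a a'"
  define p2 where "p2 = transpose (p1 b) b' \<circ> p1"
  define p3 where "p3 = transpose (p2 d) d' \<circ> p2"
  have p1: "p1 permutes A" "p1 a = a'"
    using assms by (auto simp: p1_def intro: permutes_swap_id)
  have b1: "p1 b \<in> A" "p1 b \<noteq> a'"
    using p1 assms permutes_in_image[OF p1(1)] by (auto dest: permutes_inj injD)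
  have p2: "p2 permutes A" "p2 a = a'" "p2 b = b'"
    using p1 b1 assms
    by (auto simp: p2_def transpose_def intro!: permutes_compose permutes_swap_id)
  have d2: "p2 d \<in> A" "p2 d \<noteq> a'" "p2 d \<noteq> b'"
    using p2 assms permutes_in_image[OF p2(1)] by (auto dest: permutes_inj injD)
  have "p3 permutes A" "p3 a = a'" "p3 b = b'" "p3 d = d'"
    using p2 d2 assms
    by (auto simp: p3_def transpose_def intro!: permutes_compose permutes_swap_id)
  then show thesis by (rule that)
qed

lemma normal_sym_group_conjugate:
  assumes "N \<lhd> sym_group n" "p permutes {1..n}" "k \<in> N"
  shows "p \<circ> k \<circ> inv' p \<in> N"
  using normal.inv_op_closed2[OF assms(1), of p k] assms(2,3)
  by (simp add: sym_group_carrier sym_group_mult)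

text \<open>The given product is a 3-cycle; its conjugates are all the 3-cycles, and these generate
  the alternating group.\<close>

lemma normal_sym_group_with_three_cycle:
  assumes N: "N \<lhd> sym_group n"
    and abd: "distinct [a, b, d]" "{a, b, d} \<subseteq> {1..n}"
    and mem: "transpose a b \<circ> transpose b d \<in> N"
  shows "carrier (alt_group n) \<subseteq> N"
proof -
  have sub: "subgroup N (sym_group n)" using N by (rule normal_imp_subgroup)
  have three: "three_cycles n \<subseteq> N"
  proof
    fix q assume "q \<in> three_cycles n"
    then obtain cs where cs: "q = cycle_of_list cs" "distinct cs" "length cs = 3" "set cs \<subseteq> {1..n}"
      by auto
    obtain a' b' d' where cs_def: "cs = [a', b', d']"
      using stupid_lemma[OF cs(3)] by blast
    obtain p where p: "p permutes {1..n}" "p a = a'" "p b = b'" "p d = d'"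
      using permutes_moving_three[OF abd(1), of a' b' d' "{1..n}"] abd cs cs_def by auto
    \<comment> \<open>\<open>cycle_of_list [a', b', d']\<close> unfolds to
      \<open>transpose a' b' \<circ> transpose b' d'\<close>, the same shape as the known
      element.\<close>
    have "q = p \<circ> (transpose a b \<circ> transpose b d) \<circ> inv' p"
      using p by (simp only: conjugate_two_transpositions[OF permutes_bij[OF p(1)]] cs cs_def) simp
    then show "q \<in> N"
      using normal_sym_group_conjugate[OF N p(1) mem] by simp
  qed
  show ?thesis
  proof
    fix p assume "p \<in> carrier (alt_group n)"
    then have "p \<in> generate (alt_group n) (three_cycles n)"
      using alt_group_carrier_as_three_cycles by simp
    then show "p \<in> N"
    \<comment> \<open>Generation is meant inside \<open>alt_group n\<close>, so its unit, inverse
      and product are matched with those of \<open>sym_group n\<close> case by case.\<close>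
    proof (induction rule: generate.induct)
      case one
      then show ?case using subgroup.one_closed[OF sub]
        by (simp only: alt_group_one sym_group_one)
    next
      case (incl h)
      then show ?case using three by blast
    next
      case (inv h)
      then have "h \<in> N" "h \<in> carrier (alt_group n)"
        using three three_cycles_incl by blast+
      then show ?case
        using subgroup.m_inv_closed[OF sub, of h]
        by (simp add: alt_group_inv_equality alt_group_carrier sym_group_carrier)
    next
      case (eng h1 h2)
      then show ?case using subgroup.m_closed[OF sub, of h1 h2]
        by (simp only: alt_group_mult sym_group_mult)
    qed
  qed
qed

text \<open>The only non-identity candidate is a transposition, which is odd. This settles the case
  of two points, where there are no 3-cycles to work with.\<close>

lemma permutes_doubleton_evenperm_imp_id:
  assumes "p permutes {a, b}" "evenperm p"
  shows "p = id"
proof (cases "p a = a")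
  case True
  then have "p permutes {b}"
    using permutes_superset[OF assms(1), of "{b}"] by auto
  then show ?thesis by simp
next
  case False
  then have "a \<noteq> b" "p a = b" "p b = a"
    using assms(1) permutes_in_image[OF assms(1)] permutes_inj[OF assms(1)]
    by (metis injD insertE insertI1 permutes_not_in singletonD)+
  then have "p = transpose a b"
    using assms(1) by (auto simp: fun_eq_iff transpose_def permutes_def)
  then show ?thesis using assms(2) \<open>a \<noteq> b\<close> by (simp add: evenperm_swap)
qed

text \<open>
  The last hypothesis says that the image of \<open>x\<close> modulo \<open>N\<close> commutes with every transposition.
\<close>

lemma normal_sym_group_central_odd:
  assumes N: "N \<lhd> sym_group n"
    and x: "x permutes {1..n}" "\<not> evenperm x"
    and comm: "\<And>a b. a \<in> {1..n} \<Longrightarrow> b \<in> {1..n} \<Longrightarrow>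
      transpose a b \<circ> transpose (x a) (x b) \<in> N"
  shows "carrier (alt_group n) \<subseteq> N"
proof -
  note in_iff = permutes_in_image[OF x(1)]
  have inj: "x u = x v \<longleftrightarrow> u = v" for u v
    using permutes_inj[OF x(1)] by (simp add: inj_eq)
  have sub: "subgroup N (sym_group n)" using N by (rule normal_imp_subgroup)
  have moved: "u \<in> {1..n}" if "x u \<noteq> u" for u
    using that x(1) permutes_not_in by metis
  \<comment> \<open>Either \<open>x\<close> has a cycle of length at least three, or it is an
    involution, with or without a fixed point in \<open>{1..n}\<close>.\<close>
  consider (long) a where "x a \<noteq> a" "x (x a) \<noteq> a"
    | (fixed) f where "f \<in> {1..n}" "x f = f" "\<And>u. x (x u) = u"
    | (free) "\<And>u. u \<in> {1..n} \<Longrightarrow> x u \<noteq> u" "\<And>u. x (x u) = u"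
    by metis
  then show ?thesis
  proof cases
    case (long a)
    \<comment> \<open>The two transpositions share exactly the point \<open>x a\<close>, so their
      product is a 3-cycle.\<close>
    have "transpose a (x a) \<circ> transpose (x a) (x (x a)) \<in> N"
      using comm[of a "x a"] moved[OF long(1)] in_iff by blast
    then show ?thesis
      using long moved[OF long(1)] in_iff inj
      by (intro normal_sym_group_with_three_cycle[OF N, of a "x a" "x (x a)"]) auto
  next
    case (fixed f)
    have "x \<noteq> id" using x(2) by auto
    then obtain a where a: "x a \<noteq> a" by (auto simp: fun_eq_iff)
    \<comment> \<open>As \<open>x\<close> fixes \<open>f\<close>, the transposition of
      \<open>a\<close> and \<open>f\<close> and its conjugate by \<open>x\<close> share
      \<open>f\<close>.\<close>
    have "transpose a f \<circ> transpose f (x a) \<in> N"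
      using comm[of a f] moved[OF a] fixed by (simp add: transpose_commute)
    then show ?thesis
      using a moved[OF a] in_iff[of a] fixed inj[of a f]
      by (intro normal_sym_group_with_three_cycle[OF N, of a f "x a"]) auto
  next
    case free
    have "x \<noteq> id" using x(2) by auto
    then obtain a where a: "x a \<noteq> a" by (auto simp: fun_eq_iff)
    have an: "a \<in> {1..n}" "x a \<in> {1..n}" using moved[OF a] in_iff by auto
    show ?thesis
    proof (cases "{1..n} = {a, x a}")
      case True
      then have "carrier (alt_group n) \<subseteq> {id}"
        using permutes_doubleton_evenperm_imp_id[of _ a "x a"] by (auto simp: alt_group_carrier)
      then show ?thesis using subgroup.one_closed[OF sub] by (auto simp: sym_group_one)
    next
      case False
      then obtain d where d: "d \<in> {1..n}" "d \<noteq> a" "d \<noteq> x a" using an by blast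
      have xd: "x d \<in> {1..n}" "x d \<noteq> d" "x d \<noteq> a" "x d \<noteq> x a"
        using d in_iff[of d] free inj by metis+
      \<comment> \<open>On just these four points \<open>x\<close> would be a product of two
        disjoint transpositions, hence even. Oddness thus provides a fifth point
        \<open>f\<close>.\<close>
      have "{1..n} \<noteq> {a, x a, d, x d}"
      proof
        assume eq: "{1..n} = {a, x a, d, x d}"
        have "x u = (transpose a (x a) \<circ> transpose d (x d)) u" for u
        proof (cases "u \<in> {1..n}")
          case True
          then show ?thesis unfolding eq using a d xd free(2) by (auto simp: transpose_def)
        next
          case False
          then have "x u = u" using x(1) permutes_not_in by metis
          moreover have "u \<noteq> a" "u \<noteq> x a" "u \<noteq> d" "u \<noteq> x d" using False an d xd by auto
          ultimately show ?thesis by simp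
        qed
        then have "x = transpose a (x a) \<circ> transpose d (x d)" by blast
        moreover have "evenperm (transpose a (x a) \<circ> transpose d (x d))"
          using a xd by (simp add: evenperm_comp permutation_swap_id evenperm_swap)
        ultimately show False using x(2) by simp
      qed
      then obtain f where f: "f \<in> {1..n}" "f \<noteq> a" "f \<noteq> x a" "f \<noteq> d" "f \<noteq> x d"
        using an d xd by blast
      \<comment> \<open>Conjugation by \<open>t\<close> replaces \<open>x d\<close> by
        \<open>f\<close> and keeps \<open>a\<close>, \<open>d\<close> and \<open>x a\<close>. In the
        product of the old and the new double transposition the factor \<open>transpose a d\<close>
        cancels, which leaves a 3-cycle.\<close>
      define t where "t = transpose (x d) f"
      have t: "t permutes {1..n}" unfolding t_def using f xd by (intro permutes_swap_id)
      have 1: "transpose a d \<circ> transpose (x a) (x d) \<in> N" using comm[OF an(1) d(1)] .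
      have "t \<circ> (transpose a d \<circ> transpose (x a) (x d)) \<circ> inv' t
          = transpose a d \<circ> transpose (x a) f"
        using f d xd a by (subst conjugate_two_transpositions[OF permutes_bij[OF t]])
          (auto simp: t_def)
      then have 2: "transpose a d \<circ> transpose (x a) f \<in> N"
        using normal_sym_group_conjugate[OF N t 1] by simp
      have "(transpose a d \<circ> transpose (x a) (x d)) \<circ> (transpose a d \<circ> transpose (x a) f)
          = transpose (x d) (x a) \<circ> transpose (x a) f"
        using f d xd a by (auto simp: fun_eq_iff transpose_def)
      then have "transpose (x d) (x a) \<circ> transpose (x a) f \<in> N"
        using subgroup.m_closed[OF sub 1 2] by (simp add: sym_group_mult)
      then show ?thesis
        using f d xd a an
        by (intro normal_sym_group_with_three_cycle[OF N, of "x d" "x a" f]) auto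
    qed
  qed
qed

section \<open>The two cosets of the alternating group\<close>

text \<open>Composition with a transposition flips parity and is its own inverse.\<close>

lemma transpose_l_coset_alt_group:
  assumes "n \<ge> 2"
  shows "transpose 1 2 <#\<^bsub>sym_group n\<^esub> carrier (alt_group n)
    = {p. p permutes {1..n} \<and> \<not> evenperm p}" (is "?L = ?R")
proof
  have t: "transpose 1 2 permutes {1..n}" using assms by (intro permutes_swap_id) auto
  have perm: "permutation p" if "p permutes {1..n}" for p
    using that sym_group_carrier' sym_group_carrier by blast
  have ev: "evenperm (transpose 1 2 \<circ> p) \<longleftrightarrow> \<not> evenperm p" if "p permutes {1..n}" for p :: "nat \<Rightarrow> nat"
    using perm[OF that] by (simp add: evenperm_comp permutation_swap_id evenperm_swap)
  show "?L \<subseteq> ?R"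
    using t ev by (auto simp: l_coset_def sym_group_mult alt_group_carrier intro: permutes_compose)
  show "?R \<subseteq> ?L"
  proof
    fix p assume p: "p \<in> ?R"
    then have "transpose 1 2 \<circ> p \<in> carrier (alt_group n)"
      using t ev by (auto simp: alt_group_carrier intro: permutes_compose)
    moreover have "p = transpose 1 2 \<circ> (transpose 1 2 \<circ> p)"
      by (simp add: o_assoc)
    ultimately show "p \<in> ?L" by (auto simp: l_coset_def sym_group_mult)
  qed
qed

lemma (in group) card_l_coset:
  assumes "x \<in> carrier G" "H \<subseteq> carrier G"
  shows "card (x <# H) = card H"
proof -
  have "x <# H = (\<lambda>h. x \<otimes> h) ` H" by (auto simp: l_coset_def)
  then show ?thesis
    using inj_on_subset[OF inj_on_cmult[OF assms(1)] assms(2)] by (simp add: card_image)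
qed

lemma card_l_coset_alt_group:
  assumes "n \<ge> 2"
  shows "card (transpose 1 2 <#\<^bsub>sym_group n\<^esub> carrier (alt_group n)) = card (carrier (alt_group n))"
  using assms subgroup.subset[OF alt_group_is_subgroup]
  by (intro group.card_l_coset[OF sym_group_is_group])
    (auto simp: sym_group_carrier intro: permutes_swap_id)

text \<open>If \<open>p\<close> has the parity of some \<open>s\<close> in \<open>S\<close>, then
  \<open>p \<circ> inv' s\<close> is even, so stability puts \<open>p\<close> into \<open>S\<close>.
  Hence \<open>S\<close> contains a whole parity class, and its size leaves room for nothing
  else.\<close>

lemma union_of_alt_group_cosets:
  assumes "n \<ge> 2" "S \<subseteq> carrier (sym_group n)" "card S = card (carrier (alt_group n))"
    and stable: "\<And>k s. k \<in> carrier (alt_group n) \<Longrightarrow> s \<in> S \<Longrightarrow> k \<circ> s \<in> S"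
  shows "S = carrier (alt_group n) \<or>
    S = transpose 1 2 <#\<^bsub>sym_group n\<^esub> carrier (alt_group n)"
proof -
  \<comment> \<open>As infinite sets have \<open>card\<close> 0, this gives finiteness as well as an
    element.\<close>
  have "card S \<noteq> 0"
    using alt_group_card_carrier[OF assms(1)] assms(3) fact_nonzero[of n, where 'a = nat] by linarith
  then have fin: "finite S" and "S \<noteq> {}" by (auto intro: card_ge_0_finite)
  then obtain s where s: "s \<in> S" by blast
  have s_perm: "s permutes {1..n}" using s assms(2) sym_group_carrier by blast
  have perm: "permutation p" if "p permutes {1..n}" for p
    using that sym_group_carrier' sym_group_carrier by blast
  have mem: "p \<in> S" if p: "p permutes {1..n}" "evenperm p \<longleftrightarrow> evenperm s" for p
  proof -
    have "p \<circ> inv' s \<in> carrier (alt_group n)"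
      using p s_perm perm
      by (auto simp: alt_group_carrier evenperm_comp evenperm_inv permutation_inverse
          intro: permutes_compose permutes_inv)
    then have "p \<circ> inv' s \<circ> s \<in> S" using stable s by blast
    then show ?thesis using permutes_inv_o(2)[OF s_perm] by (simp add: comp_assoc)
  qed
  show ?thesis
  proof (cases "evenperm s")
    case True
    then have "carrier (alt_group n) \<subseteq> S" using mem by (auto simp: alt_group_carrier)
    then show ?thesis using card_subset_eq[OF fin] assms(3) by metis
  next
    case False
    then have "transpose 1 2 <#\<^bsub>sym_group n\<^esub> carrier (alt_group n) \<subseteq> S"
      unfolding transpose_l_coset_alt_group[OF assms(1)] using mem by blast
    then show ?thesis
      using card_subset_eq[OF fin] assms(3) card_l_coset_alt_group[OF assms(1)] by metis
  qed
qed

theorem theorem7p8: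
  fixes n :: nat and c S :: "(nat \<Rightarrow> nat) set"
  assumes "n \<ge> 2"
    and "c \<in> conjugacy_classes (sym_group n)"
    and "\<forall>p\<in>c. \<not> evenperm p"
    and "independent_set (cayley_graph (sym_group n) c) S"
  shows "real (card S) \<le> fact n / 2 \<and>
    (real (card S) = fact n / 2 \<longleftrightarrow>
       S = carrier (alt_group n) \<or>
       S = transpose 1 2 <#\<^bsub>sym_group n\<^esub> carrier (alt_group n))"
proof -
  let ?G = "sym_group n"
  interpret group ?G by (rule sym_group_is_group)
  have ord: "order ?G = fact n" by (simp add: order_def sym_group_card_carrier)
  have fin: "finite (carrier ?G)"
    by (rule card_ge_0_finite) (simp add: sym_group_card_carrier)
  obtain x where x: "x \<in> carrier ?G"
    and c: "c = {g \<otimes>\<^bsub>?G\<^esub> x \<otimes>\<^bsub>?G\<^esub> inv\<^bsub>?G\<^esub> g | g. g \<in> carrier ?G}"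
    using assms(2) unfolding mem_conjugacy_classes_iff by blast
  have c_sub: "c \<subseteq> carrier ?G" using x c by auto
  \<comment> \<open>The identity is even.\<close>
  have c_one: "\<one>\<^bsub>?G\<^esub> \<notin> c" using assms(3) by (auto simp: sym_group_one)
  have x_c: "x \<in> c"
    unfolding c using x by (auto intro!: exI[of _ "\<one>\<^bsub>?G\<^esub>"])
  have conj_c: "g \<otimes>\<^bsub>?G\<^esub> y \<otimes>\<^bsub>?G\<^esub> inv\<^bsub>?G\<^esub> g \<in> c" if g: "g \<in> carrier ?G" and "y \<in> c" for g y
  proof -
    obtain h where h: "h \<in> carrier ?G" "y = h \<otimes>\<^bsub>?G\<^esub> x \<otimes>\<^bsub>?G\<^esub> inv\<^bsub>?G\<^esub> h"
      using \<open>y \<in> c\<close> c by blast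
    have "g \<otimes>\<^bsub>?G\<^esub> y \<otimes>\<^bsub>?G\<^esub> inv\<^bsub>?G\<^esub> g
        = (g \<otimes>\<^bsub>?G\<^esub> h) \<otimes>\<^bsub>?G\<^esub> x \<otimes>\<^bsub>?G\<^esub> inv\<^bsub>?G\<^esub> (g \<otimes>\<^bsub>?G\<^esub> h)"
      using g h x by (simp add: inv_mult_group m_assoc del: sym_group_inv_equality)
    then show ?thesis unfolding c using g h by blast
  qed
  have le: "2 * card S \<le> fact n"
    using independent_set_cayley_graph_card_le[OF fin assms(4) c_sub c_one] x_c ord by auto
  have half: "real (card S) = fact n / 2 \<longleftrightarrow> 2 * card S = fact n"
  proof -
    have "real (card S) = fact n / 2 \<longleftrightarrow> real (2 * card S) = real (fact n)" by auto
    then show ?thesis by (simp only: of_nat_eq_iff)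
  qed
  have "S = carrier (alt_group n) \<or> S = transpose 1 2 <#\<^bsub>?G\<^esub> carrier (alt_group n)"
    if eq: "2 * card S = fact n"
  proof -
    define Q where "Q = {y \<otimes>\<^bsub>?G\<^esub> inv\<^bsub>?G\<^esub> z | y z. y \<in> c \<and> z \<in> c}"
    have Q_sub: "Q \<subseteq> carrier ?G" using c_sub by (auto simp: Q_def simp del: sym_group_inv_equality)
    \<comment> \<open>Conjugation distributes over quotients and preserves the class
      \<open>c\<close>, so \<open>Q\<close> is closed under it.\<close>
    have normal: "generate ?G Q \<lhd> ?G"
    proof (rule normal_generateI[OF Q_sub])
      fix h g assume "h \<in> Q" and g: "g \<in> carrier ?G"
      then obtain y z where yz: "y \<in> c" "z \<in> c" "h = y \<otimes>\<^bsub>?G\<^esub> inv\<^bsub>?G\<^esub> z" by (auto simp: Q_def)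
      then have "y \<in> carrier ?G" "z \<in> carrier ?G" using c_sub by auto
      moreover have "inv\<^bsub>?G\<^esub> g \<otimes>\<^bsub>?G\<^esub> (g \<otimes>\<^bsub>?G\<^esub> w) = w" if "w \<in> carrier ?G" for w
        using g that by (simp add: m_assoc[symmetric] del: sym_group_inv_equality)
      ultimately have "g \<otimes>\<^bsub>?G\<^esub> h \<otimes>\<^bsub>?G\<^esub> inv\<^bsub>?G\<^esub> g
          = (g \<otimes>\<^bsub>?G\<^esub> y \<otimes>\<^bsub>?G\<^esub> inv\<^bsub>?G\<^esub> g) \<otimes>\<^bsub>?G\<^esub> inv\<^bsub>?G\<^esub> (g \<otimes>\<^bsub>?G\<^esub> z \<otimes>\<^bsub>?G\<^esub> inv\<^bsub>?G\<^esub> g)"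
        using g yz(3)
        by (simp add: inv_mult_group m_assoc del: sym_group_inv_equality)
      then show "g \<otimes>\<^bsub>?G\<^esub> h \<otimes>\<^bsub>?G\<^esub> inv\<^bsub>?G\<^esub> g \<in> Q"
        using conj_c[OF g yz(1)] conj_c[OF g yz(2)] unfolding Q_def by blast
    qed
    have x_perm: "x permutes {1..n}" using x sym_group_carrier by blast
    have comm: "transpose a b \<circ> transpose (x a) (x b) \<in> generate ?G Q"
      if "a \<in> {1..n}" "b \<in> {1..n}" for a b
    proof -
      let ?t = "transpose a b"
      have t: "?t \<in> carrier ?G" using that by (auto simp: sym_group_carrier intro: permutes_swap_id)
      \<comment> \<open>This commutator is the quotient of a conjugate of \<open>x\<close> by
        \<open>x\<close>. Bracketed the other way, it is \<open>?t\<close> times the conjugate of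
        \<open>?t\<close> by \<open>x\<close>, since \<open>?t\<close> is its own inverse.\<close>
      have "?t \<otimes>\<^bsub>?G\<^esub> x \<otimes>\<^bsub>?G\<^esub> inv\<^bsub>?G\<^esub> ?t \<otimes>\<^bsub>?G\<^esub> inv\<^bsub>?G\<^esub> x \<in> Q"
        using conj_c[OF t x_c] x_c unfolding Q_def by blast
      moreover have "?t \<otimes>\<^bsub>?G\<^esub> x \<otimes>\<^bsub>?G\<^esub> inv\<^bsub>?G\<^esub> ?t \<otimes>\<^bsub>?G\<^esub> inv\<^bsub>?G\<^esub> x = ?t \<circ> (x \<circ> ?t \<circ> inv' x)"
        using t x by (simp add: sym_group_mult comp_assoc)
      ultimately show ?thesis
        using conjugate_transpose[OF permutes_bij[OF x_perm]] by (auto intro: generate.incl)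
    qed
    have alt: "carrier (alt_group n) \<subseteq> generate ?G Q"
      using normal_sym_group_central_odd[OF normal x_perm _ comm] assms(3) x_c by blast
    have S_sub: "S \<subseteq> carrier ?G"
      using assms(4) by (simp add: independent_set_def cayley_graph_def)
    show ?thesis
    proof (rule union_of_alt_group_cosets[OF assms(1) S_sub])
      show "card S = card (carrier (alt_group n))"
        using eq alt_group_card_carrier[OF assms(1)] by linarith
      fix k s assume "k \<in> carrier (alt_group n)" "s \<in> S"
      then show "k \<circ> s \<in> S"
        using half_independent_set_cayley_graph_generate[OF fin assms(4) c_sub c_one, of k s]
          eq ord alt S_sub by (auto simp: Q_def sym_group_mult)
    qed
  qed
  moreover have "2 * card S = fact n"
    if "S = carrier (alt_group n) \<or> S = transpose 1 2 <#\<^bsub>?G\<^esub> carrier (alt_group n)"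
    using that alt_group_card_carrier[OF assms(1)] card_l_coset_alt_group[OF assms(1)] by metis
  moreover have "real (card S) \<le> fact n / 2"
  proof -
    have "real (2 * card S) \<le> real (fact n)" using le of_nat_le_iff by blast
    then show ?thesis by simp
  qed
  ultimately show ?thesis using half by blast
qed

end
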